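(* Let $G$ be a connected Lie group with Lie algebra $\mathfrak{g}$, $n=\dim\mathfrak{g}$, let $U\subset\mathbb{R}^m$ be a compact convex set containing the origin in its interior, and consider a discrete-time linear control system $g_{k+1}=f(u_k,g_k)$ on $G$ with control range $U$, such that the map $F:U\to G$, $F(x)=f(x,e)$, is continuous on $U$ and continuously differentiable on $\operatorname{int}(U)$. If the system satisfies the ad-rank condition, then $e\in\operatorname{int}(\mathcal{R}_n)$, where $\mathcal{R}_n$ is the set of points reachable from $e$ at time $n$. In particular, the system is locally controllable at $e$.
   Context: Discrete-time linear control system on $G$ with control range $U\ni 0$: $g_{k+1}=f(u_k,g_k)$, $u_k\in U$, where $f:U\times G\to G$ satisfies (1) $f(u,g)=f(u,e)\,f(0,g)$ for all $u\in U$, $g\in G$; (2) $\psi:=f(0,\cdot):G\to G$ is a Lie group automorphism. Thus $f(u,g)=F(u)\psi(g)$ with $F(u)=f(u,e)$, and $F(0)=e$. Write $f_u=f(u,\cdot)$; for $k\in\mathbb{N}$ and $u=(u_0,u_1,\dots)$ in $U$, the solution is $\varphi(k,g,u)=f_{u_{k-1}}\circ\cdots\circ f_{u_0}(g)$. Put $\mathcal{R}_k=\{\varphi(k,e,u): u\text{ a control sequence in }U\}$ and $\mathcal{R}=\bigcup_{k\in\mathbb{N}}\mathcal{R}_k$. The system is called locally controllable at $e$ if $e\in\operatorname{int}\mathcal{R}$. Derivative $\hat d$: elements of $\mathfrak{g}\cong T_eG$ are viewed as right-invariant vector fields. For a $C^1$ map $f:O\to G$ with $O$ open in $\mathbb{R}^m$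 and $x\in O$, $\hat df_x:\mathbb{R}^m\to\mathfrak{g}$ is $\hat df_x(y)=d(R_{f(x)^{-1}})_{f(x)}\big(df_x(y)\big)$, where $R_g(h)=hg$. (Since $F(0)=e$, $\hat dF_0=dF_0$ as a map $\mathbb{R}^m\to T_eG=\mathfrak{g}$.) Ad-rank condition: let $\boldsymbol{\psi}:\mathfrak{g}\to\mathfrak{g}$ be the differential of $\psi$ at $e$. The system satisfies the ad-rank condition if the smallest $\boldsymbol{\psi}$-invariant linear subspace of $\mathfrak{g}$ containing the image of $\hat dF_0$ is $\mathfrak{g}$ itself. *)

theory Defs
  imports "HOL-Analysis.Analysis" "HOL-Algebra.Group" "HOL-Library.Function_Algebras"
begin

section \<open>Pointwise vector space structure on functions\<close>

text \<open>Tangent vectors will be families of coordinate vectors indexed by charts. The following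
  instance makes the library's \<^const>\<open>subspace\<close> and \<^const>\<open>dim\<close> available for them.\<close>

instantiation "fun" :: (type, real_vector) real_vector
begin

definition scaleR_fun_def: "r *\<^sub>R f = (\<lambda>i. r *\<^sub>R f i)"

instance
  by standard (auto simp: scaleR_fun_def fun_eq_iff algebra_simps)

end

section \<open>Smooth manifolds and Lie groups\<close>

text \<open>Manifolds are modelled on a linear subspace \<open>E\<close> of a Euclidean space type; this amounts to
  modelling them on \<open>\<real>\<^sup>n\<close> with \<open>n = dim E\<close>. The reason for not always taking \<open>E = UNIV\<close> is that types of
  class \<^class>\<open>euclidean_space\<close> have positive dimension, while \<open>n = 0\<close> must not be excluded.

  In \<^term>\<open>Ck_on k E S f\<close> the set \<open>S\<close> is meant to be open relative to \<open>E\<close>. Then the values \<open>D x v\<close> for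
  \<open>v \<in> E\<close> are determined by \<open>f\<close>, whereas values outside \<open>E\<close> are irrelevant.\<close>

primrec Ck_on ::
  "nat \<Rightarrow> 'a::real_normed_vector set \<Rightarrow> 'a set \<Rightarrow> ('a \<Rightarrow> 'b::real_normed_vector) \<Rightarrow> bool" where
  "Ck_on 0 E S f \<longleftrightarrow> continuous_on S f"
| "Ck_on (Suc k) E S f \<longleftrightarrow>
     (\<exists>D. (\<forall>x\<in>S. (f has_derivative D x) (at x within S)) \<and> (\<forall>v\<in>E. Ck_on k E S (\<lambda>x. D x v)))"

text \<open>A chart is a pair of its domain and its coordinate map (whose values outside the domain are
  irrelevant).\<close>

type_synonym ('g, 'a) chart = "'g set \<times> ('g \<Rightarrow> 'a)"

definition is_chart :: "'g topology \<Rightarrow> 'a::euclidean_space set \<Rightarrow> ('g, 'a) chart \<Rightarrow> bool" where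
  "is_chart T E c \<longleftrightarrow>
     openin T (fst c) \<and> openin (top_of_set E) (snd c ` fst c) \<and>
     homeomorphic_map (subtopology T (fst c)) (top_of_set (snd c ` fst c)) (snd c)"

definition coord_rep ::
  "('g, 'a) chart \<Rightarrow> ('h, 'b) chart \<Rightarrow> ('g \<Rightarrow> 'h) \<Rightarrow> 'a \<Rightarrow> 'b" where
  "coord_rep c d h = snd d \<circ> h \<circ> inv_into (fst c) (snd c)"

definition coord_dom ::
  "('g, 'a) chart \<Rightarrow> ('h, 'b) chart \<Rightarrow> ('g \<Rightarrow> 'h) \<Rightarrow> 'a set" where
  "coord_dom c d h = snd c ` {p \<in> fst c. h p \<in> fst d}"

definition Ck_map ::
  "nat \<Rightarrow> 'g topology \<Rightarrow> 'a::euclidean_space set \<Rightarrow> ('g, 'a) chart set \<Rightarrow>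
   'h topology \<Rightarrow> ('h, 'b::euclidean_space) chart set \<Rightarrow> ('g \<Rightarrow> 'h) \<Rightarrow> bool" where
  "Ck_map k T E A T' A' h \<longleftrightarrow>
     continuous_map T T' h \<and>
     (\<forall>c\<in>A. \<forall>d\<in>A'. Ck_on k E (coord_dom c d h) (coord_rep c d h))"

definition smooth_map ::
  "'g topology \<Rightarrow> 'a::euclidean_space set \<Rightarrow> ('g, 'a) chart set \<Rightarrow>
   'h topology \<Rightarrow> ('h, 'b::euclidean_space) chart set \<Rightarrow> ('g \<Rightarrow> 'h) \<Rightarrow> bool" where
  "smooth_map T E A T' A' h \<longleftrightarrow> (\<forall>k. Ck_map k T E A T' A' h)"

text \<open>The smooth structure is given by an atlas \<open>A\<close>, which need not be maximal.\<close>

locale smooth_manifold =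
  fixes T :: "'g topology" and E :: "'a::euclidean_space set" and A :: "('g, 'a) chart set"
  assumes subspace_model: "subspace E"
    and Hausdorff: "Hausdorff_space T"
    and second_countable: "second_countable T"
    and charts: "\<And>c. c \<in> A \<Longrightarrow> is_chart T E c"
    and charts_cover: "(\<Union>c\<in>A. fst c) = topspace T"
    and charts_compatible: "\<And>c d k. c \<in> A \<Longrightarrow> d \<in> A \<Longrightarrow>
          Ck_on k E (coord_dom c d (\<lambda>p. p)) (coord_rep c d (\<lambda>p. p))"

definition prod_atlas ::
  "('g, 'a) chart set \<Rightarrow> ('h, 'b) chart set \<Rightarrow> ('g \<times> 'h, 'a \<times> 'b) chart set" where
  "prod_atlas A B = (\<lambda>(c, d). (fst c \<times> fst d, map_prod (snd c) (snd d))) ` (A \<times> B)"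

definition open_atlas :: "'c set \<Rightarrow> ('c, 'c) chart set" where
  "open_atlas W = {(W, \<lambda>x. x)}"

locale lie_group = group G + smooth_manifold T E A
  for G :: "('g, 'r) monoid_scheme" (structure)
    and T :: "'g topology" and E :: "'a::euclidean_space set" and A :: "('g, 'a) chart set" +
  assumes topspace_eq_carrier: "topspace T = carrier G"
    and smooth_mult:
      "smooth_map (prod_topology T T) (E \<times> E) (prod_atlas A A) T A (\<lambda>(g, h). g \<otimes> h)"
    and smooth_inv: "smooth_map T E A T A (\<lambda>g. inv g)"

definition lie_automorphism ::
  "('g, 'r) monoid_scheme \<Rightarrow> 'g topology \<Rightarrow> 'a::euclidean_space set \<Rightarrow> ('g, 'a) chart set \<Rightarrow>
   ('g \<Rightarrow> 'g) \<Rightarrow> bool" where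
  "lie_automorphism G T E A \<psi> \<longleftrightarrow>
     \<psi> \<in> iso G G \<and> smooth_map T E A T A \<psi> \<and> smooth_map T E A T A (inv_into (carrier G) \<psi>)"

section \<open>Tangent spaces and differentials\<close>

definition charts_at :: "('g, 'a) chart set \<Rightarrow> 'g \<Rightarrow> ('g, 'a) chart set" where
  "charts_at A p = {c \<in> A. p \<in> fst c}"

text \<open>Jacobian at \<open>p\<close> of a map between manifolds in the charts \<open>c\<close> around \<open>p\<close> and \<open>d\<close> around \<open>h p\<close>. It
  is only ever applied to vectors of the model space of the source manifold; on these,
  \<^const>\<open>frechet_derivative\<close> within a relatively open set is uniquely determined.\<close>

definition coord_deriv ::
  "('g, 'a::euclidean_space) chart \<Rightarrow> ('h, 'b::euclidean_space) chart \<Rightarrow> ('g \<Rightarrow> 'h) \<Rightarrow> 'g \<Rightarrow>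
   'a \<Rightarrow> 'b" where
  "coord_deriv c d h p = frechet_derivative (coord_rep c d h) (at (snd c p) within coord_dom c d h)"

text \<open>A tangent vector at \<open>p\<close> is a family of coordinate vectors, one for each chart around \<open>p\<close>, that
  transforms by the Jacobians of the changes of coordinates. The family is set to \<open>0\<close> at all other
  indices, so that different families are different tangent vectors.\<close>

definition tangent_space ::
  "'a::euclidean_space set \<Rightarrow> ('g, 'a) chart set \<Rightarrow> 'g \<Rightarrow> (('g, 'a) chart \<Rightarrow> 'a) set" where
  "tangent_space E A p = {v.
     (\<forall>c. c \<notin> charts_at A p \<longrightarrow> v c = 0) \<and>
     (\<forall>c\<in>charts_at A p. v c \<in> E) \<and>
     (\<forall>c\<in>charts_at A p. \<forall>d\<in>charts_at A p. v d = coord_deriv c d (\<lambda>q. q) p (v c))}"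

text \<open>The differential at \<open>p\<close> of a map from the manifold with atlas \<open>A\<close> to the one with atlas \<open>B\<close>.
  By the transformation law the result does not depend on the chart chosen around \<open>p\<close>.\<close>

definition differential ::
  "('g, 'a::euclidean_space) chart set \<Rightarrow> ('h, 'b::euclidean_space) chart set \<Rightarrow> ('g \<Rightarrow> 'h) \<Rightarrow> 'g \<Rightarrow>
   (('g, 'a) chart \<Rightarrow> 'a) \<Rightarrow> (('h, 'b) chart \<Rightarrow> 'b)" where
  "differential A B h p v = (\<lambda>d. if d \<in> charts_at B (h p)
     then (let c = (SOME c. c \<in> charts_at A p) in coord_deriv c d h p (v c)) else 0)"

text \<open>The differential at \<open>x\<close> of a map defined near \<open>x\<close> in a Euclidean space, whose tangent space at
  \<open>x\<close> is the Euclidean space itself.\<close>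

definition differential_euclidean ::
  "('h, 'b::euclidean_space) chart set \<Rightarrow> ('c::euclidean_space \<Rightarrow> 'h) \<Rightarrow> 'c \<Rightarrow>
   'c \<Rightarrow> (('h, 'b) chart \<Rightarrow> 'b)" where
  "differential_euclidean B h x y = (\<lambda>d. if d \<in> charts_at B (h x)
     then frechet_derivative (snd d \<circ> h) (at x) y else 0)"

text \<open>The Lie algebra as a vector space, a right-invariant vector field being identified with its
  value at the identity. (The bracket plays no role here.)\<close>

definition lie_algebra ::
  "('g, 'r) monoid_scheme \<Rightarrow> 'a::euclidean_space set \<Rightarrow> ('g, 'a) chart set \<Rightarrow>
   (('g, 'a) chart \<Rightarrow> 'a) set" where
  "lie_algebra G E A = tangent_space E A \<one>\<^bsub>G\<^esub>"

text \<open>The right-trivialised derivative: \<open>dF\<^sub>x(y)\<close> is moved to the identity by the differential of the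
  right translation by \<open>F(x)\<^sup>-\<^sup>1\<close>.\<close>

definition d_hat ::
  "('g, 'r) monoid_scheme \<Rightarrow> ('g, 'a::euclidean_space) chart set \<Rightarrow> ('c::euclidean_space \<Rightarrow> 'g) \<Rightarrow> 'c \<Rightarrow>
   'c \<Rightarrow> (('g, 'a) chart \<Rightarrow> 'a)" where
  "d_hat G A F x y =
     differential A A (\<lambda>h. h \<otimes>\<^bsub>G\<^esub> inv\<^bsub>G\<^esub> (F x)) (F x) (differential_euclidean A F x y)"

section \<open>Discrete-time linear control systems\<close>

locale linear_control_system = lie_group G T E A
  for G :: "('g, 'r) monoid_scheme" (structure)
    and T :: "'g topology" and E :: "'a::euclidean_space set" and A :: "('g, 'a) chart set" +
  fixes U :: "'c::euclidean_space set" and f :: "'c \<Rightarrow> 'g \<Rightarrow> 'g"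
  assumes zero_in_range: "0 \<in> U"
    and f_closed: "\<And>u g. u \<in> U \<Longrightarrow> g \<in> carrier G \<Longrightarrow> f u g \<in> carrier G"
    and f_translation: "\<And>u g. u \<in> U \<Longrightarrow> g \<in> carrier G \<Longrightarrow> f u g = f u \<one> \<otimes> f 0 g"
    and f_automorphism: "lie_automorphism G T E A (f 0)"

primrec solution :: "('c \<Rightarrow> 'g \<Rightarrow> 'g) \<Rightarrow> nat \<Rightarrow> 'g \<Rightarrow> (nat \<Rightarrow> 'c) \<Rightarrow> 'g" where
  "solution f 0 g u = g"
| "solution f (Suc k) g u = f (u k) (solution f k g u)"

definition reachable_at ::
  "('g, 'r) monoid_scheme \<Rightarrow> 'c set \<Rightarrow> ('c \<Rightarrow> 'g \<Rightarrow> 'g) \<Rightarrow> nat \<Rightarrow> 'g set" where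
  "reachable_at G U f k = {solution f k \<one>\<^bsub>G\<^esub> u |u. \<forall>i. u i \<in> U}"

definition reachable :: "('g, 'r) monoid_scheme \<Rightarrow> 'c set \<Rightarrow> ('c \<Rightarrow> 'g \<Rightarrow> 'g) \<Rightarrow> 'g set" where
  "reachable G U f = (\<Union>k. reachable_at G U f k)"

definition locally_controllable ::
  "('g, 'r) monoid_scheme \<Rightarrow> 'g topology \<Rightarrow> 'c set \<Rightarrow> ('c \<Rightarrow> 'g \<Rightarrow> 'g) \<Rightarrow> bool" where
  "locally_controllable G T U f \<longleftrightarrow> \<one>\<^bsub>G\<^esub> \<in> T interior_of reachable G U f"

text \<open>The hull is the smallest linear subspace of the Lie algebra that is invariant under the
  differential of \<open>\<psi> = f 0\<close> at the identity and contains the image of \<open>d_hat\<close> of \<open>F = (\<lambda>x. f x \<one>)\<close>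
  at \<open>0\<close>.\<close>

definition ad_rank_condition ::
  "('g, 'r) monoid_scheme \<Rightarrow> 'a::euclidean_space set \<Rightarrow> ('g, 'a) chart set \<Rightarrow>
   ('c::euclidean_space \<Rightarrow> 'g \<Rightarrow> 'g) \<Rightarrow> bool" where
  "ad_rank_condition G E A f \<longleftrightarrow>
     (\<lambda>V. subspace V \<and> V \<subseteq> lie_algebra G E A \<and> differential A A (f 0) \<one>\<^bsub>G\<^esub> ` V \<subseteq> V)
       hull range (d_hat G A (\<lambda>x. f x \<one>\<^bsub>G\<^esub>) 0)
     = lie_algebra G E A"

end

theory Submission
  imports Defs
begin

text \<open>Write \<open>F u = f u \<one>\<close> and \<open>\<psi> = f 0\<close>, fix a chart \<open>c\<close> around the identity, and let \<open>B\<close> and \<open>M\<close> be the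
  derivatives of \<open>F\<close> at \<open>0\<close> and of \<open>\<psi>\<close> at \<open>\<one>\<close> in that chart. Since the derivative of the multiplication
  at \<open>(\<one>, \<one>)\<close> is the addition, differentiating the recursion \<open>g\<^bsub>k+1\<^esub> = F (u\<^sub>k) \<otimes> \<psi> g\<^sub>k\<close> at the zero control
  gives the linear control system \<open>w\<^bsub>k+1\<^esub> = B u\<^sub>k + M w\<^sub>k\<close> on the model space \<open>E\<close>: the map taking a control
  sequence to the solution at time \<open>n\<close> has as its derivative at \<open>0\<close> the map taking it to the solution of the
  linear system (\<open>has_chart_derivative_solution\<close>).

  The reachable subspaces of the linear system increase, and once two consecutive ones agree they contain
  the range of \<open>B\<close> and are invariant under \<open>M\<close>. By the ad-rank condition, read in the chart
  (\<open>ad_rank_condition_coords\<close>), such a subspace is all of \<open>E\<close>; counting dimensions, this happens at the latest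
  at time \<open>dim E = n\<close> (\<open>linear_reach_eq\<close>). So the derivative of the end-point map is onto \<open>E\<close>, and the open
  mapping theorem for maps with a right-invertible derivative at a single point shows that the end points
  fill a neighbourhood of the identity (\<open>one_interior_reachable_at\<close>).

  Surjectivity is used in the following form: controls that depend linearly on a parameter \<open>x\<close> in the
  Euclidean space around \<open>E\<close> can be chosen such that the linear system ends in the projection of \<open>x\<close> to \<open>E\<close>
  (\<open>linear_reach_lift\<close>). The parameter space then has a fixed type, although the number of controls is \<open>n\<close>.\<close>

section \<open>Linear control systems on a vector space\<close>

lemma solution_cong:
  assumes "\<And>i. i < k \<Longrightarrow> u i = u' i"
  shows "solution f k g u = solution f k g u'"
  using assms by (induction k) auto

text \<open>The points reachable from \<open>0\<close> by the system \<open>w\<^bsub>k+1\<^esub> = B u\<^sub>k + M w\<^sub>k\<close> with unrestricted controls.\<close>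

primrec linear_reach :: "('c::real_vector \<Rightarrow> 'a::real_vector) \<Rightarrow> ('a \<Rightarrow> 'a) \<Rightarrow> nat \<Rightarrow> 'a set" where
  "linear_reach B M 0 = {0}"
| "linear_reach B M (Suc k) = (\<lambda>(y, w). B y + M w) ` (UNIV \<times> linear_reach B M k)"

lemma subspace_linear_reach:
  assumes "linear B" "linear M"
  shows "subspace (linear_reach B M k)"
proof (induction k)
  case (Suc k)
  have "linear (\<lambda>(y, w). B y + M w)"
    using assms by (auto simp: linear_iff algebra_simps scaleR_add_right)
  then show ?case
    using Suc by (auto intro!: linear_subspace_image subspace_Times)
qed auto

lemma linear_reach_mono_Suc:
  assumes "linear B" "linear M"
  shows "linear_reach B M k \<subseteq> linear_reach B M (Suc k)"
proof (induction k)
  case 0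
  show ?case
    using linear_0[OF assms(1)] linear_0[OF assms(2)] by (auto intro!: image_eqI[of _ _ "(0, 0)"])
next
  case (Suc k)
  then show ?case
    by (subst (2) linear_reach.simps, subst linear_reach.simps) (intro image_mono Sigma_mono; auto)
qed

lemma linear_reach_subset:
  assumes "subspace E" "range B \<subseteq> E" "M ` E \<subseteq> E"
  shows "linear_reach B M k \<subseteq> E"
proof (induction k)
  case 0
  show ?case using assms(1) by (simp add: subspace_0)
next
  case (Suc k)
  then show ?case using assms by (auto intro!: subspace_add)
qed

text \<open>A strictly increasing chain of subspaces of \<open>E\<close> has at most \<open>dim E\<close> steps, and where the chain stops
  growing it has reached a subspace to which the minimality assumption applies. This replaces the use of
  the Cayley-Hamilton theorem in the classical rank criterion.\<close>

lemma linear_reach_eq: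
  fixes B :: "'c::real_vector \<Rightarrow> 'a::euclidean_space"
  assumes lin: "linear B" "linear M"
    and E: "subspace E" "range B \<subseteq> E" "M ` E \<subseteq> E"
    and min: "\<And>W. subspace W \<Longrightarrow> W \<subseteq> E \<Longrightarrow> range B \<subseteq> W \<Longrightarrow> M ` W \<subseteq> W \<Longrightarrow> W = E"
  shows "linear_reach B M (dim E) = E"
proof -
  let ?W = "linear_reach B M"
  have sub: "subspace (?W k)" and le: "?W k \<subseteq> E" and inc: "?W k \<subseteq> ?W (Suc k)" for k
    using subspace_linear_reach[OF lin] linear_reach_subset[OF E] linear_reach_mono_Suc[OF lin] by auto
  have "k \<le> dim (?W k) \<or> ?W k = E" for k
  proof (induction k)
    case (Suc k)
    show ?case
    proof (cases "?W k = ?W (Suc k)")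
      case True
      have B: "B y \<in> ?W (Suc k)" for y
        using subspace_0[OF sub[of k]] linear_0[OF lin(2)] by (auto intro!: image_eqI[of _ _ "(y, 0)"])
      have M: "M w \<in> ?W (Suc k)" if "w \<in> ?W k" for w
        using that linear_0[OF lin(1)] by (auto intro!: image_eqI[of _ _ "(0, w)"])
      have "?W k = E"
      proof (rule min[OF sub le])
        show "range B \<subseteq> ?W k" unfolding True using B by blast
        show "M ` ?W k \<subseteq> ?W k" by (subst (2) True) (use M in blast)
      qed
      with True show ?thesis by metis
    next
      case False
      then have "dim (?W k) \<noteq> dim (?W (Suc k))"
        using subspace_dim_equal[OF sub sub inc, of k] by auto
      moreover have "dim (?W k) \<le> dim (?W (Suc k))"
        by (rule dim_subset[OF inc])
      moreover have "?W k \<noteq> E"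
        using False inc le[of "Suc k"] by auto
      ultimately show ?thesis using Suc by linarith
    qed
  qed simp
  then show ?thesis
    using subspace_dim_equal[OF sub E(1) le] by blast
qed

text \<open>Choose for each vector of the standard basis a control sequence that steers to its image under \<open>Q\<close>, and
  extend linearly; this works because the end point depends linearly on the controls. The induction removes
  the last control first.\<close>

lemma linear_reach_lift:
  fixes B :: "'c::real_vector \<Rightarrow> 'a::real_vector" and Q :: "'x::euclidean_space \<Rightarrow> 'a"
  assumes lin: "linear B" "linear M"
    and "linear Q" "range Q \<subseteq> linear_reach B M k"
  shows "\<exists>K. (\<forall>i. linear (K i)) \<and> (\<forall>x. solution (\<lambda>y w. B y + M w) k 0 (\<lambda>i. K i x) = Q x)"
  using assms(3,4)
proof (induction k arbitrary: Q)
  case 0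
  have "linear (\<lambda>x::'x. 0::'c)" by (simp add: linear_iff)
  with 0 show ?case by (intro exI[of _ "\<lambda>_ _. 0"]) auto
next
  case (Suc k)
  have "\<exists>y w. w \<in> linear_reach B M k \<and> Q b = B y + M w" for b
    using Suc.prems(2) by force
  then obtain y w where w: "\<And>b. w b \<in> linear_reach B M k" and Q: "\<And>b. Q b = B (y b) + M (w b)"
    by metis
  define Y where "Y = (\<lambda>x. \<Sum>b\<in>Basis. (x \<bullet> b) *\<^sub>R y b)"
  define Z where "Z = (\<lambda>x. \<Sum>b\<in>Basis. (x \<bullet> b) *\<^sub>R w b)"
  have linY: "linear Y" and linZ: "linear Z"
    by (auto simp: Y_def Z_def linear_iff inner_add_left scaleR_add_left sum.distrib scaleR_sum_right)
  have "range Z \<subseteq> linear_reach B M k"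
    using w by (auto simp: Z_def intro!: subspace_sum subspace_scale subspace_linear_reach lin)
  from Suc.IH[OF linZ this] obtain K where K: "\<And>i. linear (K i)"
    and KZ: "\<And>x. solution (\<lambda>y w. B y + M w) k 0 (\<lambda>i. K i x) = Z x" by auto
  have Qx: "B (Y x) + M (Z x) = Q x" for x
  proof -
    have "Q x = Q (\<Sum>b\<in>Basis. (x \<bullet> b) *\<^sub>R b)" by (simp add: euclidean_representation)
    also have "\<dots> = (\<Sum>b\<in>Basis. (x \<bullet> b) *\<^sub>R Q b)"
      using Suc.prems(1) by (simp add: linear_sum linear_scale)
    also have "\<dots> = B (Y x) + M (Z x)"
      using lin by (simp add: Q Y_def Z_def linear_sum linear_scale scaleR_add_right sum.distrib)
    finally show ?thesis by simp
  qed
  have "solution (\<lambda>y w. B y + M w) (Suc k) 0 (\<lambda>i. (K(k := Y)) i x) = Q x" for x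
  proof -
    have "solution (\<lambda>y w. B y + M w) k 0 (\<lambda>i. (K(k := Y)) i x) = Z x"
      unfolding KZ[symmetric] by (rule solution_cong) auto
    then show ?thesis by (simp add: Qx)
  qed
  moreover have "linear ((K(k := Y)) i)" for i
    using K linY by simp
  ultimately show ?case by blast
qed

section \<open>Differentiating maps into a manifold in a chart\<close>

text \<open>Needed for the space of tangent vectors, which is not a Euclidean space type.\<close>

lemma dim_linear_injective_image:
  fixes f :: "'a::real_vector \<Rightarrow> 'b::real_vector"
  assumes f: "linear f" and S: "subspace S" and inj: "inj_on f S"
  shows "dim (f ` S) = dim S"
proof -
  obtain B where B: "B \<subseteq> S" "independent B" "S \<subseteq> span B" "card B = dim S"
    using basis_exists by blast
  have span: "span B = S"
    using B(1,3) S by (simp add: span_subspace)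
  have "independent (f ` B)"
    using linear_independent_injective_image[OF f B(2)] inj by (simp add: span)
  moreover have "span (f ` B) = span (f ` S)"
    using linear_span_image[OF f, of B] linear_span_image[OF f, of S] S
    by (simp add: span span_eq_iff[THEN iffD2])
  ultimately have "dim (f ` S) = card (f ` B)"
    by (intro dim_eq_card)
  also have "\<dots> = card B"
    using inj_on_subset[OF inj B(1)] by (rule card_image)
  finally show ?thesis using B(4) by simp
qed

lemma is_chart_inj_on:
  assumes "is_chart T E c"
  shows "inj_on (snd c) (fst c)"
proof -
  have "topspace (subtopology T (fst c)) = fst c"
    using assms by (metis is_chart_def openin_subset topspace_subtopology_subset)
  then show ?thesis
    using assms unfolding is_chart_def by (metis homeomorphic_imp_injective_map)
qed

lemma is_chart_continuous:
  assumes "is_chart T E c"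
  shows "continuous_map (subtopology T (fst c)) euclidean (snd c)"
proof -
  have "homeomorphic_map (subtopology T (fst c)) (top_of_set (snd c ` fst c)) (snd c)"
    using assms by (simp add: is_chart_def)
  from homeomorphic_imp_continuous_map[OF this] show ?thesis
    by (simp add: continuous_map_in_subtopology)
qed

text \<open>Derivatives in charts of a manifold are taken within subsets of \<open>E\<close>, which need not be open in the
  ambient Euclidean space. Maps from an open set of a normed space into the manifold have ordinary
  derivatives in charts instead, with the usual uniqueness; all Jacobians below are computed by composing
  with such maps. Continuity is asked near the point, not only at it, since the open mapping theorem
  needs it there.\<close>

definition has_chart_derivative ::
  "'g topology \<Rightarrow> ('g, 'a::euclidean_space) chart \<Rightarrow> ('x::real_normed_vector \<Rightarrow> 'g) \<Rightarrow>
   ('x \<Rightarrow> 'a) \<Rightarrow> 'x \<Rightarrow> bool" where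
  "has_chart_derivative T c s D x \<longleftrightarrow>
     (\<exists>N. open N \<and> x \<in> N \<and> continuous_map (top_of_set N) T s \<and> s ` N \<subseteq> fst c \<and>
          ((\<lambda>y. snd c (s y)) has_derivative D) (at x))"

lemma open_continuous_preimage:
  assumes "open N" "continuous_map (top_of_set N) T s" "openin T V"
  shows "open {x \<in> N. s x \<in> V}"
  using openin_continuous_map_preimage[OF assms(2,3)] assms(1) by (simp add: openin_open_eq)

lemma has_chart_derivativeI:
  assumes "open N" "x \<in> N" "continuous_map (top_of_set N) T s" "openin T (fst c)" "s x \<in> fst c"
    and "((\<lambda>y. snd c (s y)) has_derivative D) (at x)"
  shows "has_chart_derivative T c s D x"
  unfolding has_chart_derivative_def
proof (intro exI conjI)
  show "continuous_map (top_of_set {y \<in> N. s y \<in> fst c}) T s"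
    using assms(3) by (rule continuous_map_from_subtopology_mono) auto
qed (use assms open_continuous_preimage[OF assms(1,3,4)] in auto)

lemma has_chart_derivative_unique:
  assumes "has_chart_derivative T c s D x" "has_chart_derivative T c s D' x"
  shows "D = D'"
  using assms has_derivative_unique unfolding has_chart_derivative_def by blast

lemma has_chart_derivative_linear: "has_chart_derivative T c s D x \<Longrightarrow> linear D"
  unfolding has_chart_derivative_def using has_derivative_linear by blast

lemma has_chart_derivative_const:
  assumes "openin T (fst c)" "p \<in> fst c"
  shows "has_chart_derivative T c (\<lambda>_. p) (\<lambda>_. 0) x"
  by (rule has_chart_derivativeI[where N = UNIV])
     (use assms openin_subset in \<open>auto simp: subset_iff\<close>)

lemma has_chart_derivative_transform:
  assumes "has_chart_derivative T c s D x"
    and Q: "open Q" "x \<in> Q" "\<And>y. y \<in> Q \<Longrightarrow> s y \<in> fst c \<Longrightarrow> s' y = s y"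
  shows "has_chart_derivative T c s' D x"
proof -
  obtain N where N: "open N" "x \<in> N" "continuous_map (top_of_set N) T s" "s ` N \<subseteq> fst c"
    "((\<lambda>y. snd c (s y)) has_derivative D) (at x)"
    using assms(1) unfolding has_chart_derivative_def by blast
  have eq: "s' y = s y" if "y \<in> N \<inter> Q" for y
    using that N(4) Q(3) by blast
  have open_NQ: "open (N \<inter> Q)" "x \<in> N \<inter> Q"
    using N Q by auto
  show ?thesis
    unfolding has_chart_derivative_def
  proof (intro exI conjI)
    have "continuous_map (top_of_set (N \<inter> Q)) T s"
      by (rule continuous_map_from_subtopology_mono[OF N(3)]) auto
    then show "continuous_map (top_of_set (N \<inter> Q)) T s'"
      by (rule continuous_map_eq) (simp add: eq)
    show "((\<lambda>y. snd c (s' y)) has_derivative D) (at x)"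
      by (rule has_derivative_transform_within_open[OF N(5) open_NQ]) (simp add: eq)
  qed (use N eq open_NQ in auto)
qed

lemma has_chart_derivative_chain:
  assumes s: "has_chart_derivative T c s D x"
    and inj: "inj_on (snd c) (fst c)"
    and h: "continuous_map T T' h"
    and d: "openin T' (fst d)" "h (s x) \<in> fst d"
    and H: "(coord_rep c d h has_derivative H) (at (snd c (s x)) within coord_dom c d h)"
  shows "has_chart_derivative T' d (\<lambda>y. h (s y)) (\<lambda>v. H (D v)) x"
proof -
  obtain N where N: "open N" "x \<in> N" "continuous_map (top_of_set N) T s" "s ` N \<subseteq> fst c"
    "((\<lambda>y. snd c (s y)) has_derivative D) (at x)"
    using s unfolding has_chart_derivative_def by blast
  have cont: "continuous_map (top_of_set N) T' (\<lambda>y. h (s y))"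
    using continuous_map_compose[OF N(3) h] by (simp add: o_def)
  define N' where "N' = {y \<in> N. h (s y) \<in> fst d}"
  have N': "open N'" "x \<in> N'"
    using open_continuous_preimage[OF N(1) cont d(1)] N(2) d(2) by (auto simp: N'_def)
  have "(\<lambda>y. snd c (s y)) ` N' \<subseteq> coord_dom c d h"
    using N(4) by (auto simp: N'_def coord_dom_def)
  then have "((\<lambda>y. coord_rep c d h (snd c (s y))) has_derivative (\<lambda>v. H (D v))) (at x within N')"
    by (rule has_derivative_in_compose[OF has_derivative_at_withinI[OF N(5)] has_derivative_subset[OF H]])
  then have "((\<lambda>y. coord_rep c d h (snd c (s y))) has_derivative (\<lambda>v. H (D v))) (at x)"
    unfolding at_within_open[OF N'(2,1)] .
  then have "((\<lambda>y. snd d (h (s y))) has_derivative (\<lambda>v. H (D v))) (at x)"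
  proof (rule has_derivative_transform_within_open[OF _ N'])
    fix y assume "y \<in> N'"
    then have "s y \<in> fst c" using N(4) by (auto simp: N'_def)
    then show "coord_rep c d h (snd c (s y)) = snd d (h (s y))"
      by (simp add: coord_rep_def inv_into_f_f[OF inj])
  qed
  then show ?thesis
    by (rule has_chart_derivativeI[where N = N, OF N(1,2) cont d])
qed

lemma has_chart_derivative_compose:
  assumes s: "has_chart_derivative T c s D (k x)"
    and k: "continuous_on UNIV k" "(k has_derivative K) (at x)"
  shows "has_chart_derivative T c (\<lambda>y. s (k y)) (\<lambda>v. D (K v)) x"
proof -
  obtain N where N: "open N" "k x \<in> N" "continuous_map (top_of_set N) T s" "s ` N \<subseteq> fst c"
    "((\<lambda>y. snd c (s y)) has_derivative D) (at (k x))"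
    using s unfolding has_chart_derivative_def by blast
  show ?thesis
    unfolding has_chart_derivative_def
  proof (intro exI conjI)
    show "open (k -` N)" by (rule open_vimage[OF N(1) k(1)])
    have "continuous_map (top_of_set (k -` N)) (top_of_set N) k"
      using continuous_on_subset[OF k(1)] by (auto simp: continuous_map_in_subtopology)
    from continuous_map_compose[OF this N(3)]
    show "continuous_map (top_of_set (k -` N)) T (\<lambda>y. s (k y))" by (simp add: o_def)
    show "((\<lambda>y. snd c (s (k y))) has_derivative (\<lambda>v. D (K v))) (at x)"
      by (rule has_derivative_compose[OF k(2) N(5)])
  qed (use N in auto)
qed

lemma has_chart_derivative_Pair:
  assumes "has_chart_derivative T c s D x" "has_chart_derivative T' d t D' x"
  shows "has_chart_derivative (prod_topology T T') (fst c \<times> fst d, map_prod (snd c) (snd d))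
           (\<lambda>y. (s y, t y)) (\<lambda>v. (D v, D' v)) x"
proof -
  obtain N where N: "open N" "x \<in> N" "continuous_map (top_of_set N) T s" "s ` N \<subseteq> fst c"
    "((\<lambda>y. snd c (s y)) has_derivative D) (at x)"
    using assms(1) unfolding has_chart_derivative_def by blast
  obtain N' where N': "open N'" "x \<in> N'" "continuous_map (top_of_set N') T' t" "t ` N' \<subseteq> fst d"
    "((\<lambda>y. snd d (t y)) has_derivative D') (at x)"
    using assms(2) unfolding has_chart_derivative_def by blast
  show ?thesis
    unfolding has_chart_derivative_def
  proof (intro exI conjI)
    show "continuous_map (top_of_set (N \<inter> N')) (prod_topology T T') (\<lambda>y. (s y, t y))"
      using continuous_map_from_subtopology_mono[OF N(3)] continuous_map_from_subtopology_mono[OF N'(3)]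
      by (simp add: continuous_map_paired)
    show "((\<lambda>y. snd (fst c \<times> fst d, map_prod (snd c) (snd d)) (s y, t y))
            has_derivative (\<lambda>v. (D v, D' v))) (at x)"
      using has_derivative_Pair[OF N(5) N'(5)] by simp
  qed (use N N' in auto)
qed

text \<open>In coordinates \<open>s\<close> stays in \<open>E\<close>, so composing it with a linear projection onto \<open>E\<close> changes nothing; by
  uniqueness of the derivative the projection fixes \<open>D v\<close>.\<close>

lemma has_chart_derivative_in_model:
  assumes E: "subspace E" and c: "is_chart T E c" and s: "has_chart_derivative T c s D x"
  shows "D v \<in> E"
proof -
  obtain P where P: "range P \<subseteq> E" "linear P" "\<And>w. w \<in> E \<Longrightarrow> P w = w"
    using linear_exists_left_inverse_on[OF linear_id E] by auto
  obtain N where N: "open N" "x \<in> N" "s ` N \<subseteq> fst c" "((\<lambda>y. snd c (s y)) has_derivative D) (at x)"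
    using s unfolding has_chart_derivative_def by blast
  have img: "snd c ` fst c \<subseteq> E"
    using c openin_imp_subset unfolding is_chart_def by blast
  have "((\<lambda>y. P (snd c (s y))) has_derivative (\<lambda>v. P (D v))) (at x)"
    using has_derivative_compose[OF N(4) linear_imp_has_derivative[OF P(2)]] .
  then have "((\<lambda>y. snd c (s y)) has_derivative (\<lambda>v. P (D v))) (at x)"
    by (rule has_derivative_transform_within_open[OF _ N(1,2)]) (use N(3) img P(3) in blast)
  with N(4) have "D = (\<lambda>v. P (D v))"
    by (rule has_derivative_unique)
  then have "D v = P (D v)" by metis
  with P(1) show ?thesis by (metis rangeI subsetD)
qed

text \<open>Straight lines in the chart provide enough curves to determine the value of a Jacobian on every vector
  of the model space.\<close>

lemma chart_curve:
  assumes E: "subspace E" and c: "is_chart T E c" and p: "p \<in> fst c" and v: "v \<in> E"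
  obtains s :: "real \<Rightarrow> 'g" where "has_chart_derivative T c s (\<lambda>t. t *\<^sub>R v) 0" "s 0 = p"
proof -
  have top: "topspace (subtopology T (fst c)) = fst c"
    using c by (metis is_chart_def openin_subset topspace_subtopology_subset)
  obtain g where g: "homeomorphic_maps (subtopology T (fst c)) (top_of_set (snd c ` fst c)) (snd c) g"
    using c unfolding is_chart_def homeomorphic_map_maps by blast
  have gc: "g (snd c q) = q" "snd c q \<in> E" if "q \<in> fst c" for q
    using g that top c openin_imp_subset unfolding homeomorphic_maps_def is_chart_def by fastforce+
  have cg: "snd c (g z) = z" if "z \<in> snd c ` fst c" for z
    using g that unfolding homeomorphic_maps_def by fastforce
  have contg: "continuous_map (top_of_set (snd c ` fst c)) T g"
    using g unfolding homeomorphic_maps_def by (simp add: continuous_map_in_subtopology)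
  obtain V where V: "open V" "snd c ` fst c = E \<inter> V"
    using c unfolding is_chart_def openin_open by blast
  define l where "l = (\<lambda>t::real. snd c p + t *\<^sub>R v)"
  have lE: "l t \<in> E" for t
    unfolding l_def using E p v gc(2) by (simp add: subspace_add subspace_scale)
  have contl: "continuous_on UNIV l"
    unfolding l_def by (intro continuous_intros)
  define N where "N = l -` V"
  have N: "open N" "0 \<in> N"
    using open_vimage[OF V(1) contl] p V(2) by (auto simp: N_def l_def)
  have lN: "l t \<in> snd c ` fst c" if "t \<in> N" for t
    using that lE V(2) by (auto simp: N_def)
  have gN: "g (l t) \<in> fst c" if "t \<in> N" for t
    using lN[OF that] gc(1) by force
  have "continuous_map (top_of_set N) (top_of_set (snd c ` fst c)) l"
    using lN continuous_on_subset[OF contl] by (auto simp: continuous_map_in_subtopology)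
  from continuous_map_compose[OF this contg]
  have "continuous_map (top_of_set N) T (\<lambda>t. g (l t))" by (simp add: o_def)
  moreover have "((\<lambda>t. snd c (g (l t))) has_derivative (\<lambda>t. t *\<^sub>R v)) (at 0)"
  proof (rule has_derivative_transform_within_open[OF _ N])
    show "(l has_derivative (\<lambda>t. t *\<^sub>R v)) (at 0)"
      unfolding l_def by (auto intro!: derivative_eq_intros)
  qed (simp add: cg lN)
  ultimately have "has_chart_derivative T c (\<lambda>t. g (l t)) (\<lambda>t. t *\<^sub>R v) 0"
    unfolding has_chart_derivative_def
    using N gN by (intro exI[of _ N]) auto
  moreover have "g (l 0) = p"
    using gc(1)[OF p] by (simp add: l_def)
  ultimately show ?thesis by (rule that)
qed

lemma Ck_map_has_coord_deriv:
  assumes "Ck_map (Suc k) T E A T' A' h" "c \<in> charts_at A p" "d \<in> charts_at A' (h p)"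
  shows "(coord_rep c d h has_derivative coord_deriv c d h p) (at (snd c p) within coord_dom c d h)"
proof -
  have "snd c p \<in> coord_dom c d h"
    using assms(2,3) by (auto simp: charts_at_def coord_dom_def)
  moreover have "Ck_on (Suc k) E (coord_dom c d h) (coord_rep c d h)"
    using assms by (auto simp: Ck_map_def charts_at_def)
  ultimately show ?thesis
    unfolding coord_deriv_def
    by (auto simp: frechet_derivative_works[symmetric] differentiable_def)
qed

text \<open>The map \<open>h\<close> is only assumed to be the identity on the chart domain, so that the lemma also covers
  the translation by the identity element, which is arbitrary outside the carrier.\<close>

lemma coord_deriv_ident:
  assumes E: "subspace E" and c: "is_chart T E c" and p: "p \<in> fst c" and v: "v \<in> E"
    and h: "\<And>q. q \<in> fst c \<Longrightarrow> h q = q"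
  shows "coord_deriv c c h p v = v"
proof -
  have inj: "inj_on (snd c) (fst c)" by (rule is_chart_inj_on[OF c])
  have op: "openin T (fst c)" using c by (simp add: is_chart_def)
  have rep: "coord_rep c c h z = z" if "z \<in> coord_dom c c h" for z
    using that h by (auto simp: coord_rep_def coord_dom_def inv_into_f_f[OF inj])
  have dom: "coord_dom c c h = coord_dom c c (\<lambda>q. q)"
    using h by (auto simp: coord_dom_def image_iff)
  have pd: "snd c p \<in> coord_dom c c h" 
    using p h by (auto simp: coord_dom_def)
  have "((\<lambda>z. z) has_derivative (\<lambda>v. v)) (at (snd c p) within coord_dom c c h)"
    by (rule has_derivative_ident)
  then have "(coord_rep c c h has_derivative (\<lambda>v. v)) (at (snd c p) within coord_dom c c h)"
    by (rule has_derivative_transform[OF pd, rotated]) (simp add: rep)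
  then have "(coord_rep c c h has_derivative coord_deriv c c h p) (at (snd c p) within coord_dom c c h)"
    unfolding coord_deriv_def frechet_derivative_works[symmetric] by (auto simp: differentiable_def)
  then have *: "(coord_rep c c (\<lambda>q. q) has_derivative coord_deriv c c h p)
      (at (snd c p) within coord_dom c c (\<lambda>q. q))"
    unfolding dom
    by (rule has_derivative_transform[OF pd[unfolded dom], rotated])
       (auto simp: coord_rep_def coord_dom_def inv_into_f_f[OF inj] h)
  obtain s :: "real \<Rightarrow> 'b" where s: "has_chart_derivative T c s (\<lambda>t. t *\<^sub>R v) 0" "s 0 = p"
    using chart_curve[OF E c p v] .
  have "has_chart_derivative T c s (\<lambda>t. coord_deriv c c h p (t *\<^sub>R v)) 0"
    using has_chart_derivative_chain[OF s(1) inj _ op, of "\<lambda>q. q" "coord_deriv c c h p"] * s(2) p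
    by simp
  from has_chart_derivative_unique[OF this s(1)] show ?thesis
    by (metis scaleR_one)
qed

section \<open>Tangent vectors in a chart\<close>

text \<open>The transformation law is oriented so that rewriting with it eliminates Jacobians; in the opposite
  direction it would loop.\<close>

lemma tangent_spaceD:
  assumes "v \<in> tangent_space E A p"
  shows "c \<notin> charts_at A p \<Longrightarrow> v c = 0"
    and "c \<in> charts_at A p \<Longrightarrow> v c \<in> E"
    and "c \<in> charts_at A p \<Longrightarrow> d \<in> charts_at A p \<Longrightarrow> coord_deriv c d (\<lambda>q. q) p (v c) = v d"
proof -
  note v = assms[unfolded tangent_space_def mem_Collect_eq]
  show "c \<notin> charts_at A p \<Longrightarrow> v c = 0"
    by (rule v[THEN conjunct1, rule_format])
  show "c \<in> charts_at A p \<Longrightarrow> v c \<in> E"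
    by (rule v[THEN conjunct2, THEN conjunct1, rule_format])
  show "c \<in> charts_at A p \<Longrightarrow> d \<in> charts_at A p \<Longrightarrow> coord_deriv c d (\<lambda>q. q) p (v c) = v d"
    by (rule v[THEN conjunct2, THEN conjunct2, rule_format, symmetric])
qed

lemma tangent_spaceI:
  assumes "\<And>c. c \<notin> charts_at A p \<Longrightarrow> v c = 0"
    and "\<And>c. c \<in> charts_at A p \<Longrightarrow> v c \<in> E"
    and "\<And>c d. c \<in> charts_at A p \<Longrightarrow> d \<in> charts_at A p \<Longrightarrow>
           coord_deriv c d (\<lambda>q. q) p (v c) = v d"
  shows "v \<in> tangent_space E A p"
  unfolding tangent_space_def
  by (intro CollectI conjI allI impI ballI assms(1,2) assms(3)[symmetric])

context smooth_manifold
begin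

lemma charts_atD:
  assumes "c \<in> charts_at A p"
  shows "is_chart T E c" "openin T (fst c)" "p \<in> fst c" "inj_on (snd c) (fst c)"
proof -
  have c: "c \<in> A" and p: "p \<in> fst c"
    using assms by (simp_all add: charts_at_def)
  show chart: "is_chart T E c" by (rule charts[OF c])
  show "inj_on (snd c) (fst c)" by (rule is_chart_inj_on[OF chart])
  show "openin T (fst c)" using chart by (simp add: is_chart_def)
  show "p \<in> fst c" by (rule p)
qed

lemma has_chart_derivative_Ck_map:
  assumes "Ck_map (Suc k) T E A T A h" "c \<in> charts_at A p" "d \<in> charts_at A (h p)"
    and "has_chart_derivative T c s D x" "s x = p"
  shows "has_chart_derivative T d (\<lambda>y. h (s y)) (\<lambda>v. coord_deriv c d h p (D v)) x"
proof (rule has_chart_derivative_chain[OF assms(4)])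
  show "continuous_map T T h" using assms(1) by (simp add: Ck_map_def)
qed (use assms(3,5) charts_atD[OF assms(2)] charts_atD[OF assms(3)]
      Ck_map_has_coord_deriv[OF assms(1-3)] in simp_all)

lemma Ck_map_ident: "Ck_map k T E A T A (\<lambda>q. q)"
  using charts_compatible by (simp add: Ck_map_def)

lemma coord_deriv_linear:
  assumes "Ck_map (Suc k) T E A T A h" "c \<in> charts_at A p" "d \<in> charts_at A (h p)"
  shows "linear (coord_deriv c d h p)"
  by (rule has_derivative_linear[OF Ck_map_has_coord_deriv[OF assms]])

lemma coord_deriv_in_model:
  assumes "Ck_map (Suc k) T E A T A h" "c \<in> charts_at A p" "d \<in> charts_at A (h p)" "v \<in> E"
  shows "coord_deriv c d h p v \<in> E"
proof -
  obtain s :: "real \<Rightarrow> 'g" where s: "has_chart_derivative T c s (\<lambda>t. t *\<^sub>R v) 0" "s 0 = p"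
    using chart_curve[OF subspace_model charts_atD(1,3)[OF assms(2)] assms(4)] .
  have "coord_deriv c d h p (1 *\<^sub>R v) \<in> E"
    by (rule has_chart_derivative_in_model[OF subspace_model charts_atD(1)[OF assms(3)]
          has_chart_derivative_Ck_map[OF assms(1-3) s]])
  then show ?thesis by simp
qed

text \<open>Both sides are the velocity, in the chart \<open>d'\<close>, of the curve that has velocity \<open>v\<close> in the chart \<open>c\<close>.\<close>

lemma coord_deriv_transition:
  assumes c: "c \<in> charts_at A p" and d: "d \<in> charts_at A p" and d': "d' \<in> charts_at A p"
    and v: "v \<in> E"
  shows "coord_deriv d d' (\<lambda>q. q) p (coord_deriv c d (\<lambda>q. q) p v) = coord_deriv c d' (\<lambda>q. q) p v"
proof -
  obtain s :: "real \<Rightarrow> 'g" where s: "has_chart_derivative T c s (\<lambda>t. t *\<^sub>R v) 0" "s 0 = p"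
    using chart_curve[OF subspace_model charts_atD(1,3)[OF c] v] .
  note tr = has_chart_derivative_Ck_map[OF Ck_map_ident[of "Suc 0"], where p = p and x = 0]
  have "has_chart_derivative T d' s (\<lambda>t. coord_deriv d d' (\<lambda>q. q) p (coord_deriv c d (\<lambda>q. q) p (t *\<^sub>R v))) 0"
    by (rule tr[OF d d' tr[OF c d s] s(2)])
  from fun_cong[OF has_chart_derivative_unique[OF this tr[OF c d' s]], of 1] show ?thesis
    by simp
qed

lemma subspace_tangent_space: "subspace (tangent_space E A p)"
proof -
  have lin: "linear (coord_deriv c d (\<lambda>q. q) p)" if "c \<in> charts_at A p" "d \<in> charts_at A p" for c d
    by (rule coord_deriv_linear[OF Ck_map_ident that])
  show ?thesis
  proof (rule subspaceI)
    show "0 \<in> tangent_space E A p"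
      by (rule tangent_spaceI) (simp_all add: lin linear_0 subspace_0[OF subspace_model])
  next
    fix v w assume vw: "v \<in> tangent_space E A p" "w \<in> tangent_space E A p"
    show "v + w \<in> tangent_space E A p"
      by (rule tangent_spaceI)
         (simp_all add: lin linear_add subspace_add[OF subspace_model]
            tangent_spaceD[OF vw(1)] tangent_spaceD[OF vw(2)])
  next
    fix r v assume v: "v \<in> tangent_space E A p"
    show "r *\<^sub>R v \<in> tangent_space E A p"
      by (rule tangent_spaceI)
         (simp_all add: lin linear_scale scaleR_fun_def subspace_scale[OF subspace_model]
            tangent_spaceD[OF v])
  qed
qed

text \<open>Evaluation at a chart identifies the tangent space with the model space: the transformation law
  determines all components from one, and by the chain rule for changes of coordinates it defines a tangent
  vector from any given component.\<close>

lemma tangent_space_coords: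
  assumes c: "c \<in> charts_at A p"
  shows "inj_on (\<lambda>v. v c) (tangent_space E A p)" and "(\<lambda>v. v c) ` tangent_space E A p = E"
proof -
  show "inj_on (\<lambda>v. v c) (tangent_space E A p)"
  proof (rule inj_onI)
    fix v w assume v: "v \<in> tangent_space E A p" and w: "w \<in> tangent_space E A p"
      and eq: "v c = w c"
    have "v d = w d" for d
    proof (cases "d \<in> charts_at A p")
      case True
      then show ?thesis
        using tangent_spaceD(3)[OF v c True] tangent_spaceD(3)[OF w c True] eq by simp
    next
      case False
      then show ?thesis
        using tangent_spaceD(1)[OF v] tangent_spaceD(1)[OF w] by simp
    qed
    then show "v = w" by (rule ext)
  qed
  show "(\<lambda>v. v c) ` tangent_space E A p = E"
  proof (intro subset_antisym subsetI)
    fix w assume w: "w \<in> E"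
    define v where "v = (\<lambda>d. if d \<in> charts_at A p then coord_deriv c d (\<lambda>q. q) p w else 0)"
    have "v \<in> tangent_space E A p"
      by (rule tangent_spaceI)
         (simp_all add: v_def coord_deriv_in_model[OF Ck_map_ident c _ w]
            coord_deriv_transition[OF c _ _ w])
    moreover have "v c = w"
      using coord_deriv_ident[OF subspace_model charts_atD(1,3)[OF c] w] c by (simp add: v_def)
    ultimately show "w \<in> (\<lambda>v. v c) ` tangent_space E A p" by blast
  qed (use tangent_spaceD(2)[OF _ c] in auto)
qed

lemma dim_tangent_space:
  assumes "c \<in> charts_at A p"
  shows "dim (tangent_space E A p) = dim E"
proof -
  have lin: "linear (\<lambda>v::('g, 'a) chart \<Rightarrow> 'a. v c)"
    by (simp add: linear_iff scaleR_fun_def)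
  from dim_linear_injective_image[OF lin subspace_tangent_space tangent_space_coords(1)[OF assms]]
  show ?thesis
    using tangent_space_coords(2)[OF assms] by simp
qed

end

section \<open>The derivative of the multiplication\<close>

context lie_group
begin

lemma charts_at_one: "\<exists>c. c \<in> charts_at A \<one>"
proof -
  have "\<one> \<in> (\<Union>c\<in>A. fst c)"
    using charts_cover topspace_eq_carrier one_closed by metis
  then show ?thesis by (auto simp: charts_at_def)
qed

lemma continuous_mult: "continuous_map (prod_topology T T) T (\<lambda>(g, h). g \<otimes> h)"
  using smooth_mult by (simp add: smooth_map_def Ck_map_def)

text \<open>The Jacobian \<open>H\<close> of the multiplication at \<open>(\<one>, \<one>)\<close> is linear, so it suffices to know it on \<open>(v, 0)\<close>
  and \<open>(0, v)\<close>. There it is \<open>v\<close>, because multiplying a curve by the constant \<open>\<one>\<close> does not change it.\<close>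

lemma has_chart_derivative_mult:
  assumes c: "c \<in> charts_at A \<one>"
    and s: "has_chart_derivative T c s D x" "s x = \<one>"
    and t: "has_chart_derivative T c t D' x" "t x = \<one>"
  shows "has_chart_derivative T c (\<lambda>y. s y \<otimes> t y) (\<lambda>v. D v + D' v) x"
proof -
  note chart = charts_atD[OF c]
  define cc where "cc = (fst c \<times> fst c, map_prod (snd c) (snd c))"
  define H where "H = coord_deriv cc c (\<lambda>(g, h). g \<otimes> h) (\<one>, \<one>)"
  have cc: "cc \<in> charts_at (prod_atlas A A) (\<one>, \<one>)"
    using c by (auto simp: cc_def charts_at_def prod_atlas_def)
  have H: "(coord_rep cc c (\<lambda>(g, h). g \<otimes> h) has_derivative H)
      (at (snd cc (\<one>, \<one>)) within coord_dom cc c (\<lambda>(g, h). g \<otimes> h))"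
    unfolding H_def
    by (rule Ck_map_has_coord_deriv[OF _ cc])
       (use smooth_mult c in \<open>auto simp: smooth_map_def\<close>)
  then have linH: "linear H" by (rule has_derivative_linear)
  have inj: "inj_on (snd cc) (fst cc)"
    using chart(4) by (auto simp: cc_def inj_on_def)
  have prod: "has_chart_derivative T c (\<lambda>y. s' y \<otimes> t' y) (\<lambda>v. H (S v, S' v)) z"
    if "has_chart_derivative T c s' S z" "has_chart_derivative T c t' S' z" "s' z = \<one>" "t' z = \<one>"
    for s' t' S S' and z :: "'z::real_normed_vector"
    using has_chart_derivative_chain[OF has_chart_derivative_Pair[OF that(1,2), folded cc_def] inj
        continuous_mult chart(2), of H] H that chart(3) by simp
  have carr: "g \<in> carrier G" if "g \<in> fst c" for g
    using that openin_subset[OF chart(2)] topspace_eq_carrier by auto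
  have one: "has_chart_derivative T c (\<lambda>_. \<one>) (\<lambda>_. 0) (0::real)"
    by (rule has_chart_derivative_const[OF chart(2,3)])
  have H1: "H (v, 0) = v" and H2: "H (0, v) = v" if v: "v \<in> E" for v
  proof -
    obtain r :: "real \<Rightarrow> 'g" where r: "has_chart_derivative T c r (\<lambda>t. t *\<^sub>R v) 0" "r 0 = \<one>"
      using chart_curve[OF subspace_model chart(1,3) v] .
    have "has_chart_derivative T c (\<lambda>y. r y \<otimes> \<one>) (\<lambda>t. t *\<^sub>R v) 0"
      by (rule has_chart_derivative_transform[OF r(1) open_UNIV]) (simp_all add: carr)
    from has_chart_derivative_unique[OF prod[OF r(1) one r(2)] this] show "H (v, 0) = v"
      by (auto dest: fun_cong[of _ _ 1])
    have "has_chart_derivative T c (\<lambda>y. \<one> \<otimes> r y) (\<lambda>t. t *\<^sub>R v) 0"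
      by (rule has_chart_derivative_transform[OF r(1) open_UNIV]) (simp_all add: carr)
    from has_chart_derivative_unique[OF prod[OF one r(1) _ r(2)] this] show "H (0, v) = v"
      by (auto dest: fun_cong[of _ _ 1])
  qed
  have "H (D v, D' v) = D v + D' v" for v
  proof -
    have "H (D v, D' v) = H ((D v, 0) + (0, D' v))" by simp
    also have "\<dots> = D v + D' v"
      unfolding linear_add[OF linH]
      by (simp add: H1 H2 has_chart_derivative_in_model[OF subspace_model chart(1) s(1)]
            has_chart_derivative_in_model[OF subspace_model chart(1) t(1)])
    finally show ?thesis .
  qed
  with prod[OF s(1) t(1) s(2) t(2)] show ?thesis by simp
qed

end

section \<open>The linearised control system\<close>

lemma has_chart_derivative_Ck_map_euclidean:
  assumes F: "Ck_map (Suc k) (top_of_set Q) UNIV (open_atlas Q) T A F"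
    and Q: "open Q" "x \<in> Q"
    and d: "d \<in> charts_at A (F x)" "openin T (fst d)"
  shows "has_chart_derivative T d F (frechet_derivative (snd d \<circ> F) (at x)) x"
proof -
  let ?c = "(Q, \<lambda>x. x)"
  have c: "?c \<in> charts_at (open_atlas Q) x"
    using Q by (simp add: charts_at_def open_atlas_def)
  have id: "has_chart_derivative (top_of_set Q) ?c (\<lambda>x. x) (\<lambda>v. v) x"
    by (rule has_chart_derivativeI[OF Q]) (use Q in auto)
  have "has_chart_derivative T d F (coord_deriv ?c d F x) x"
    using has_chart_derivative_chain[OF id _ _ d(2), of F "coord_deriv ?c d F x"] d
      Ck_map_has_coord_deriv[OF F c d(1)] F
    by (simp add: charts_at_def Ck_map_def)
  moreover from this have "coord_deriv ?c d F x = frechet_derivative (snd d \<circ> F) (at x)"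
    unfolding has_chart_derivative_def comp_def using frechet_derivative_at by blast
  ultimately show ?thesis by simp
qed

context linear_control_system
begin

lemma f_zero_one: "f 0 \<one> = \<one>"
proof -
  have "f 0 \<in> hom G G"
    using f_automorphism by (simp add: lie_automorphism_def iso_def)
  then show ?thesis
    by (rule hom_one[OF _ is_group is_group])
qed

lemma Ck_map_f_zero: "Ck_map k T E A T A (f 0)"
  using f_automorphism by (simp add: lie_automorphism_def smooth_map_def)

lemma solution_zero: "solution f k \<one> (\<lambda>_. 0) = \<one>"
  by (induction k) (simp_all add: f_zero_one)

text \<open>The derivative of the solution is itself a solution, of the linearised system. Controls are only
  admissible for parameters near \<open>0\<close>, which is where the identity \<open>f u g = F u \<otimes> \<psi> g\<close> may be used.\<close>

lemma has_chart_derivative_solution: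
  fixes K :: "nat \<Rightarrow> 'x::euclidean_space \<Rightarrow> 'c"
  assumes c: "c \<in> charts_at A \<one>"
    and F: "has_chart_derivative T c (\<lambda>y. f y \<one>) B 0"
    and U: "0 \<in> interior U"
    and K: "\<And>i. linear (K i)"
  shows "has_chart_derivative T c (\<lambda>x. solution f k \<one> (\<lambda>i. K i x))
           (\<lambda>x. solution (\<lambda>y w. B y + coord_deriv c c (f 0) \<one> w) k 0 (\<lambda>i. K i x)) 0"
proof (induction k)
  case 0
  show ?case
    using has_chart_derivative_const[OF charts_atD(2,3)[OF c]] by simp
next
  case (Suc k)
  let ?M = "coord_deriv c c (f 0) \<one>"
  let ?s = "\<lambda>x. solution f k \<one> (\<lambda>i. K i x)"
  have K0: "K i 0 = 0" for i
    using K by (rule linear_0)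
  have s0: "?s 0 = \<one>"
    by (simp add: K0 solution_zero)
  have contK: "continuous_on UNIV (K k)"
    using K by (simp add: linear_continuous_on linear_conv_bounded_linear)
  obtain N where N: "open N" "0 \<in> N" "?s ` N \<subseteq> fst c"
    using Suc.IH[unfolded has_chart_derivative_def] by (elim exE conjE) (rule that)
  have N': "open (N \<inter> K k -` interior U)" "0 \<in> N \<inter> K k -` interior U"
    using N U open_vimage[OF open_interior contK] by (auto simp: K0)
  have ctrl: "has_chart_derivative T c (\<lambda>x. f (K k x) \<one>) (\<lambda>v. B (K k v)) 0"
    by (rule has_chart_derivative_compose[OF _ contK linear_imp_has_derivative[OF K]])
       (simp add: K0 F)
  have drift: "has_chart_derivative T c (\<lambda>x. f 0 (?s x))
      (\<lambda>v. ?M (solution (\<lambda>y w. B y + ?M w) k 0 (\<lambda>i. K i v))) 0"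
    by (rule has_chart_derivative_Ck_map[OF Ck_map_f_zero c _ Suc s0]) (simp add: f_zero_one c)
  have "has_chart_derivative T c (\<lambda>x. f (K k x) \<one> \<otimes> f 0 (?s x))
      (\<lambda>v. B (K k v) + ?M (solution (\<lambda>y w. B y + ?M w) k 0 (\<lambda>i. K i v))) 0"
    by (rule has_chart_derivative_mult[OF c ctrl _ drift]) (simp_all add: K0 s0 solution_zero f_zero_one)
  then show ?case
    unfolding solution.simps
  proof (rule has_chart_derivative_transform[OF _ N'])
    fix x assume x: "x \<in> N \<inter> K k -` interior U"
    then have "?s x \<in> carrier G"
      using N(3) openin_subset[OF charts_atD(2)[OF c]] topspace_eq_carrier by blast
    then show "f (K k x) (?s x) = f (K k x) \<one> \<otimes> f 0 (?s x)"
      using x interior_subset by (intro f_translation) auto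
  qed
qed

text \<open>The open mapping theorem is about Euclidean space types, but the coordinates of end points lie in the
  subspace \<open>E\<close>. With a linear projection \<open>P\<close> onto \<open>E\<close> and controls \<open>K i x\<close> for which the linearised system ends
  in \<open>P x\<close>, the map \<open>h x = c (s x) + (x - P x)\<close>, where \<open>s x\<close> is the end point, fills in the missing
  directions and has the identity as its derivative at \<open>0\<close>. A value of \<open>h\<close> lying in \<open>E\<close> can only come from
  a parameter \<open>x \<in> E\<close>, and for such parameters \<open>h x\<close> is just \<open>c (s x)\<close>.\<close>

lemma one_interior_reachable_at:
  assumes c: "c \<in> charts_at A \<one>"
    and F: "has_chart_derivative T c (\<lambda>y. f y \<one>) B 0"
    and U: "0 \<in> interior U"
    and full: "linear_reach B (coord_deriv c c (f 0) \<one>) n = E"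
  shows "\<one> \<in> T interior_of reachable_at G U f n"
proof -
  let ?M = "coord_deriv c c (f 0) \<one>"
  note chart = charts_atD[OF c]
  have linM: "linear ?M"
    by (rule coord_deriv_linear[OF Ck_map_f_zero c]) (simp add: f_zero_one c)
  obtain P :: "'a \<Rightarrow> 'a" where P: "range P \<subseteq> E" "linear P" "\<And>w. w \<in> E \<Longrightarrow> P w = w"
    using linear_exists_left_inverse_on[OF linear_id subspace_model] by auto
  obtain K :: "nat \<Rightarrow> 'a \<Rightarrow> 'c" where K: "\<And>i. linear (K i)"
    and KP: "\<And>x. solution (\<lambda>y w. B y + ?M w) n 0 (\<lambda>i. K i x) = P x"
    using linear_reach_lift[OF has_chart_derivative_linear[OF F] linM P(2), of n] P(1) full by auto
  have K0: "K i 0 = 0" for i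
    using K by (rule linear_0)
  define s where "s = (\<lambda>x. solution f n \<one> (\<lambda>i. K i x))"
  have "has_chart_derivative T c s P 0"
    using has_chart_derivative_solution[where K = K and k = n, OF c F U K] unfolding s_def KP .
  then obtain N where N: "open N" "0 \<in> N" "continuous_map (top_of_set N) T s" "s ` N \<subseteq> fst c"
    "((\<lambda>x. snd c (s x)) has_derivative P) (at 0)"
    unfolding has_chart_derivative_def by blast
  define N' where "N' = N \<inter> (\<Inter>i<n. K i -` interior U)"
  have "open (K i -` interior U)" for i
    using K by (intro open_vimage) (simp_all add: linear_continuous_on linear_conv_bounded_linear)
  then have N': "open N'" "0 \<in> N'"
    using N U by (auto simp: N'_def K0)
  define h where "h = (\<lambda>x. snd c (s x) + (x - P x))"
  have contP: "continuous_on S P" for S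
    using P(2) by (simp add: linear_continuous_on linear_conv_bounded_linear)
  have "continuous_map (top_of_set N') T s"
    by (rule continuous_map_from_subtopology_mono[OF N(3)]) (simp add: N'_def)
  then have "continuous_map (top_of_set N') (subtopology T (fst c)) s"
    using N(4) by (auto simp: continuous_map_in_subtopology N'_def)
  from continuous_map_compose[OF this is_chart_continuous[OF chart(1)]]
  have "continuous_on N' (\<lambda>x. snd c (s x))"
    by (simp add: o_def)
  then have conth: "continuous_on N' h"
    unfolding h_def by (intro continuous_intros contP)
  have "(h has_derivative (\<lambda>x. P x + (x - P x))) (at 0)"
    unfolding h_def
    by (intro has_derivative_add has_derivative_diff has_derivative_ident N(5)
          linear_imp_has_derivative P(2))
  then have derh: "(h has_derivative (\<lambda>x. x)) (at 0)" by simp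
  have "h 0 \<in> interior (h ` N')"
    by (rule sussmann_open_mapping[OF N'(1) conth N'(2) derh bounded_linear_ident])
       (use N' in \<open>auto simp: interior_open\<close>)
  moreover have "h 0 = snd c \<one>"
    using linear_0[OF P(2)] by (simp add: h_def s_def K0 solution_zero)
  ultimately obtain Q where Q: "open Q" "snd c \<one> \<in> Q" "Q \<subseteq> h ` N'"
    by (auto simp: interior_def)
  define V where "V = {p \<in> fst c. snd c p \<in> Q}"
  have top: "topspace (subtopology T (fst c)) = fst c"
    using topspace_subtopology_subset openin_subset[OF chart(2)] by blast
  have "openin (subtopology T (fst c)) V"
    using openin_continuous_map_preimage[OF is_chart_continuous[OF chart(1)], of Q] Q(1)
    unfolding top V_def by simp
  then have "openin T V"
    using chart(2) by (rule openin_trans_full)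
  moreover have "\<one> \<in> V"
    using Q(2) chart(3) by (simp add: V_def)
  moreover have "V \<subseteq> reachable_at G U f n"
  proof
    fix p assume "p \<in> V"
    then have p: "p \<in> fst c" "snd c p \<in> Q" by (simp_all add: V_def)
    then obtain x where x: "x \<in> N'" "snd c p = snd c (s x) + (x - P x)"
      using Q(3) by (auto simp: h_def)
    have sx: "s x \<in> fst c"
      using x(1) N(4) by (auto simp: N'_def)
    have KU: "K i x \<in> U" if "i < n" for i
      using x(1) that interior_subset[of U] by (auto simp: N'_def)
    have img: "snd c ` fst c \<subseteq> E"
      using chart(1) openin_imp_subset unfolding is_chart_def by blast
    have "P x + (snd c p - snd c (s x)) \<in> E"
      using img p(1) sx P(1) by (intro subspace_add subspace_diff subspace_model) auto
    then have "x \<in> E"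
      using x(2) by simp
    then have "snd c p = snd c (s x)"
      using x(2) P(3) by simp
    then have "p = s x"
      using chart(4) p(1) sx by (auto dest: inj_onD)
    \<comment> \<open>Only the first \<open>n\<close> values of the control are known to lie in \<open>U\<close>; the others do not influence the
      end point and are replaced by \<open>0\<close>.\<close>
    also have "\<dots> = solution f n \<one> (\<lambda>i. if i < n then K i x else 0)"
      unfolding s_def by (rule solution_cong) simp
    also have "\<dots> \<in> reachable_at G U f n"
      using KU zero_in_range
      by (auto simp: reachable_at_def intro!: exI[of _ "\<lambda>i. if i < n then K i x else 0"])
    finally show "p \<in> reachable_at G U f n" .
  qed
  ultimately show ?thesis
    unfolding interior_of_def by blast
qed

text \<open>The tangent vectors whose component in the chart \<open>c\<close> lies in \<open>W\<close> form an invariant subspace of the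
  Lie algebra that contains the range of \<open>d_hat\<close>, hence the hull, which is the whole Lie algebra. As the
  components of its elements fill \<open>E\<close>, it follows that \<open>W = E\<close>. The chart \<open>c\<close> has to be the one that
  \<^const>\<open>differential\<close> selects at the identity: then the differentials in question have, in this chart, the
  components \<open>M (v c)\<close> and \<open>B y\<close> by mere unfolding.\<close>

lemma ad_rank_condition_coords:
  fixes c B
  defines "c \<equiv> SOME c. c \<in> charts_at A \<one>"
  defines "B \<equiv> frechet_derivative (snd c \<circ> (\<lambda>x. f x \<one>)) (at 0)"
  assumes rank: "ad_rank_condition G E A f"
    and W: "subspace W" "W \<subseteq> E" "range B \<subseteq> W" "coord_deriv c c (f 0) \<one> ` W \<subseteq> W"
  shows "W = E"
proof -
  let ?L = "tangent_space E A \<one>"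
  let ?d = "differential A A (f 0) \<one>"
  let ?S = "\<lambda>V. subspace V \<and> V \<subseteq> ?L \<and> ?d ` V \<subseteq> V"
  let ?R = "range (d_hat G A (\<lambda>x. f x \<one>) 0)"
  have c: "c \<in> charts_at A \<one>"
    unfolding c_def using charts_at_one by (rule someI_ex)
  have hull: "?S hull ?R = ?L"
    using rank by (simp add: ad_rank_condition_def lie_algebra_def)
  have d: "?d v c = coord_deriv c c (f 0) \<one> (v c)" for v
    using c by (simp add: differential_def f_zero_one c_def[symmetric])
  have d_hat: "d_hat G A (\<lambda>x. f x \<one>) 0 y c = B y" for y
  proof -
    have "d_hat G A (\<lambda>x. f x \<one>) 0 y c = coord_deriv c c (\<lambda>h. h \<otimes> inv \<one>) \<one> (B y)"
      using c by (simp add: d_hat_def differential_def differential_euclidean_def f_zero_one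
          c_def[symmetric] B_def)
    also have "\<dots> = B y"
    proof (rule coord_deriv_ident[OF subspace_model charts_atD(1,3)[OF c]])
      show "B y \<in> E" using W by blast
      fix q assume "q \<in> fst c"
      then have "q \<in> carrier G"
        using openin_subset[OF charts_atD(2)[OF c]] topspace_eq_carrier by blast
      then show "q \<otimes> inv \<one> = q" by simp
    qed
    finally show ?thesis .
  qed
  define V where "V = {v \<in> ?L. v c \<in> W}"
  have SV: "?S V"
  proof (intro conjI)
    have "linear (\<lambda>v::('g, 'a) chart \<Rightarrow> 'a. v c)"
      by (simp add: linear_iff scaleR_fun_def)
    then have "subspace (?L \<inter> (\<lambda>v. v c) -` W)"
      by (intro subspace_inter subspace_tangent_space linear_subspace_vimage W(1))
    moreover have "?L \<inter> (\<lambda>v. v c) -` W = V"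
      by (auto simp: V_def)
    ultimately show "subspace V" by simp
    show "?d ` V \<subseteq> V"
    proof (intro subsetI, elim imageE)
      fix w v assume w: "w = ?d v" and v: "v \<in> V"
      \<comment> \<open>An intersection of invariant sets is invariant. As the hull is the whole tangent space, this
        shows that the differential maps the tangent space to itself.\<close>
      have "?d v \<in> ?S hull ?R"
        unfolding hull_def
      proof (intro InterI, elim CollectE conjE)
        fix X assume X: "?R \<subseteq> X" "subspace X" "X \<subseteq> ?L" "?d ` X \<subseteq> X"
        have "?S hull ?R \<subseteq> X"
          by (rule hull_minimal[where S = ?S]) (use X in auto)
        then show "?d v \<in> X"
          using v X(4) hull by (auto simp: V_def)
      qed
      then show "w \<in> V"
        using v W(4) hull by (auto simp: V_def w d)
    qed
  qed (simp add: V_def)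
  have RV: "?R \<subseteq> V"
  proof
    fix v assume v: "v \<in> ?R"
    then have "v \<in> ?L"
      using hull_subset[of ?R ?S] hull by auto
    with v W(3) show "v \<in> V"
      by (auto simp: V_def d_hat)
  qed
  have "?S hull ?R \<subseteq> V"
    by (rule hull_minimal[where S = ?S, OF RV SV])
  then have LV: "?L \<subseteq> V"
    unfolding hull .
  have "E \<subseteq> W"
  proof
    fix w assume "w \<in> E"
    then have "w \<in> (\<lambda>v. v c) ` ?L"
      unfolding tangent_space_coords(2)[OF c] .
    then obtain v where v: "w = v c" "v \<in> ?L"
      by (rule imageE)
    from LV v(2) have "v \<in> V" by (rule subsetD)
    then show "w \<in> W" by (simp add: V_def v(1))
  qed
  with W(2) show ?thesis by (rule subset_antisym)
qed

end

theorem theorem3p18: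
  fixes G :: "('g, 'r) monoid_scheme"
    and T :: "'g topology"
    and E :: "'a::euclidean_space set"
    and A :: "('g, 'a) chart set"
    and U :: "(real ^ 'm) set"
    and f :: "real ^ 'm \<Rightarrow> 'g \<Rightarrow> 'g"
    and n :: nat
  assumes "lie_group G T E A"
    and "connected_space T"
    and "n = dim (lie_algebra G E A)"
    and "compact U" and "convex U" and "0 \<in> interior U"
    and "linear_control_system G T E A U f"
    and "continuous_map (top_of_set U) T (\<lambda>x. f x \<one>\<^bsub>G\<^esub>)"
    and "Ck_map 1 (top_of_set (interior U)) UNIV (open_atlas (interior U)) T A (\<lambda>x. f x \<one>\<^bsub>G\<^esub>)"
    and "ad_rank_condition G E A f"
  shows "\<one>\<^bsub>G\<^esub> \<in> T interior_of (reachable_at G U f n) \<and> locally_controllable G T U f"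
proof -
  interpret linear_control_system G T E A U f by fact
  define c where "c = (SOME c. c \<in> charts_at A \<one>\<^bsub>G\<^esub>)"
  define M where "M = coord_deriv c c (f 0) \<one>\<^bsub>G\<^esub>"
  define B where "B = frechet_derivative (snd c \<circ> (\<lambda>x. f x \<one>\<^bsub>G\<^esub>)) (at 0)"
  have c: "c \<in> charts_at A \<one>\<^bsub>G\<^esub>"
    unfolding c_def using charts_at_one by (rule someI_ex)
  have F: "has_chart_derivative T c (\<lambda>x. f x \<one>\<^bsub>G\<^esub>) B 0"
    unfolding B_def
    by (rule has_chart_derivative_Ck_map_euclidean[OF _ open_interior])
       (use assms c charts_atD(2)[OF c] in \<open>simp_all add: f_zero_one\<close>)
  have c': "c \<in> charts_at A (f 0 \<one>\<^bsub>G\<^esub>)"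
    using c by (simp add: f_zero_one)
  have "n = dim E"
    using assms(3) dim_tangent_space[OF c] by (simp add: lie_algebra_def)
  moreover have "linear_reach B M (dim E) = E"
  proof (rule linear_reach_eq)
    show "linear B" by (rule has_chart_derivative_linear[OF F])
    show "linear M" unfolding M_def by (rule coord_deriv_linear[OF Ck_map_f_zero c c'])
    show "subspace E" by (rule subspace_model)
    show "range B \<subseteq> E"
      using has_chart_derivative_in_model[OF subspace_model charts_atD(1)[OF c] F] by blast
    show "M ` E \<subseteq> E"
      unfolding M_def using coord_deriv_in_model[OF Ck_map_f_zero c c'] by blast
  next
    fix W assume "subspace W" "W \<subseteq> E" "range B \<subseteq> W" "M ` W \<subseteq> W"
    then show "W = E"
      unfolding B_def M_def c_def by (intro ad_rank_condition_coords assms)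
  qed
  ultimately have "\<one>\<^bsub>G\<^esub> \<in> T interior_of reachable_at G U f n"
    using one_interior_reachable_at[OF c F] assms by (simp add: M_def)
  moreover have "reachable_at G U f n \<subseteq> reachable G U f"
    by (auto simp: reachable_def)
  ultimately show ?thesis
    unfolding locally_controllable_def using interior_of_mono by blast
qed

end
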